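(* Let $m,n\ge 1$ be integers and let $k_1,\dots,k_n$ be non-negative integers. If $m\ge k_1+k_2+\cdots+k_n+n-1$, then the simplicial complex $\Delta_{m,n}^{k_1,\dots,k_n;\mathbf{1}}$ is shellable.
   Context: Write $[t]=\{1,\dots,t\}$. The chessboard $[m]\times[n]$ has $n$ rows $[m]\times\{i\}$ ($i\in[n]$), each of length $m$, and $m$ columns $\{j\}\times[n]$ ($j\in[m]$). The complex $\Delta_{m,n}^{k_1,\dots,k_n;\mathbf{1}}$ is the simplicial complex whose simplices are the subsets $A\subset[m]\times[n]$ (rook placements) such that $|A\cap([m]\times\{i\})|\le k_i$ for every $i\in[n]$ (at most $k_i$ rooks in the $i$-th row) and $|A\cap(\{j\}\times[n])|\le 1$ for every $j\in[m]$ (at most one rook in each column). A pure finite simplicial complex is shellable if there is a linear order $\ll$ on its facets (a shelling order) such that for every pair of facets $A\ll B$ there exist a facet $C\ll B$ and a vertex $v\in B$ with $A\cap B\subset C\cap B=B\setminus\{v\}$. *)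

theory Defs
  imports Main
begin

(* An abstract simplicial complex is given by its set of simplices, the empty simplex included. *)

definition finite_simplicial_complex :: "'a set set \<Rightarrow> bool" where
  "finite_simplicial_complex K \<longleftrightarrow>
     finite K \<and> {} \<in> K \<and> (\<forall>A\<in>K. finite A) \<and> (\<forall>A\<in>K. \<forall>B. B \<subseteq> A \<longrightarrow> B \<in> K)"

definition facets :: "'a set set \<Rightarrow> 'a set set" where
  "facets K = {A \<in> K. \<forall>B\<in>K. A \<subseteq> B \<longrightarrow> B = A}"

definition pure_complex :: "'a set set \<Rightarrow> bool" where
  "pure_complex K \<longleftrightarrow> (\<forall>A\<in>facets K. \<forall>B\<in>facets K. card A = card B)"

(* (A, B) \<in> r means that A strictly precedes B. *)
definition shelling_order :: "'a set set \<Rightarrow> ('a set \<times> 'a set) set \<Rightarrow> bool" where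
  "shelling_order K r \<longleftrightarrow>
     strict_linear_order_on (facets K) r \<and>
     (\<forall>A\<in>facets K. \<forall>B\<in>facets K. (A, B) \<in> r \<longrightarrow>
        (\<exists>C\<in>facets K. (C, B) \<in> r \<and>
           (\<exists>v\<in>B. A \<inter> B \<subseteq> C \<inter> B \<and> C \<inter> B = B - {v})))"

definition shellable :: "'a set set \<Rightarrow> bool" where
  "shellable K \<longleftrightarrow>
     finite_simplicial_complex K \<and> pure_complex K \<and> (\<exists>r. shelling_order K r)"

(* A square (j, i) lies in column j and row i; only the values k 1, ..., k n matter. *)
definition chessboard_complex :: "nat \<Rightarrow> nat \<Rightarrow> (nat \<Rightarrow> nat) \<Rightarrow> (nat \<times> nat) set set" where
  "chessboard_complex m n k =
     {A. A \<subseteq> {1..m} \<times> {1..n} \<and>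
         (\<forall>i\<in>{1..n}. card (A \<inter> ({1..m} \<times> {i})) \<le> k i) \<and>
         (\<forall>j\<in>{1..m}. card (A \<inter> ({j} \<times> {1..n})) \<le> 1)}"

end

theory Submission
  imports Defs "HOL-Library.Fun_Lexorder"
begin

text \<open>
  Read a facet as a word on the columns \<open>1, \<dots>, m\<close> in which the letter \<open>i > 0\<close>
  (a rook in row \<open>i\<close>) occurs \<open>k i\<close> times and \<open>0\<close> stands for an empty column; the
  hypothesis says that there are at least \<open>n - 1\<close> zeros. Two facets are adjacent when one arises
  from the other by exchanging a letter with a zero. Order the words lexicographically, where
  at a position preceded by \<open>z\<close> zeros the letters are ranked as \<open>z + 1 < 0 < \<dots>\<close>.

  Let \<open>f\<close> precede \<open>g\<close>, and let \<open>p\<close> be the first position where they differ.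
  If \<open>g p = 0\<close>, then \<open>f p\<close> is the favoured letter, and some later occurrence of it in
  \<open>g\<close> that is not one in \<open>f\<close> may be moved to \<open>p\<close>. If \<open>g p \<noteq> 0\<close> and \<open>g\<close> has a later zero,
  exchange it with \<open>g p\<close>. Otherwise all zeros precede \<open>p\<close>, so each of the letters
  \<open>1, \<dots>, n - 1\<close> was favoured at one of them; as \<open>f\<close> and \<open>g\<close> have the same letters from \<open>p\<close> on,
  some position \<open>j \<ge> p\<close> has \<open>f j \<noteq> g j < n\<close>, and this letter may be moved to that zero.
\<close>

subsection \<open>Lexicographic order on words\<close>

text \<open>The \<open>Suc\<close> keeps other letters above the value 1 of zero, so
  \<open>rank z\<close> is injective with unique minimum at the favoured letter
  \<open>z\<close>.\<close>

definition rank :: "nat \<Rightarrow> nat \<Rightarrow> nat" where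
  "rank z a = (if a = z then 0 else if a = 0 then 1 else Suc a)"

text \<open>Words vanish at the dummy position \<open>0\<close>, so the number of zeros at positions below \<open>j > 0\<close>
  already is one more than the number of empty columns before \<open>j\<close>.\<close>

definition zeros_before :: "(nat \<Rightarrow> nat) \<Rightarrow> nat \<Rightarrow> nat" where
  "zeros_before f j = card {i. i < j \<and> f i = 0}"

text \<open>Recoding letters by their rank turns the position-dependent order into the plain
  lexicographic order \<open>less_fun\<close>.\<close>

definition key :: "(nat \<Rightarrow> nat) \<Rightarrow> nat \<Rightarrow> nat" where
  "key f j = rank (zeros_before f j) (f j)"

lemma rank_inject: "rank z a = rank z b \<longleftrightarrow> a = b"
  by (auto simp: rank_def split: if_splits)

lemma zeros_before_cong:
  assumes "\<And>i. i < j \<Longrightarrow> f i = g i"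
  shows "zeros_before f j = zeros_before g j"
  unfolding zeros_before_def using assms by (metis (mono_tags, lifting))

lemma key_cong:
  assumes "\<And>i. i \<le> j \<Longrightarrow> f i = g i"
  shows "key f j = key g j"
  using assms zeros_before_cong[of j f g] by (simp add: key_def)

text \<open>The ranking at a position depends only on earlier letters, so a word is decoded from its
  keys from left to right.\<close>

lemma eq_if_key_eq:
  assumes "\<And>i. i < p \<Longrightarrow> key f i = key g i" and "i < p"
  shows "f i = g i"
  using assms(2)
proof (induction i rule: less_induct)
  case (less i)
  then have "zeros_before f i = zeros_before g i"
    by (intro zeros_before_cong) simp
  then show ?case
    using assms(1)[OF less.prems] by (simp add: key_def rank_inject)
qed

lemma key_inject: "key f = key g \<longleftrightarrow> f = g"
proof
  assume "key f = key g"
  then have "f i = g i" for i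
    using eq_if_key_eq[of "Suc i" f g i] by simp
  then show "f = g" ..
qed simp

lemma less_fun_keyE:
  assumes "less_fun (key f) (key g)"
  obtains p where "\<And>i. i < p \<Longrightarrow> f i = g i"
    and "rank (zeros_before g p) (f p) < rank (zeros_before g p) (g p)"
proof -
  obtain p where p: "key f p < key g p" "\<And>i. i < p \<Longrightarrow> key f i = key g i"
    using assms by (auto elim: less_funE)
  then have "f i = g i" if "i < p" for i
    using eq_if_key_eq that by blast
  moreover from this have "rank (zeros_before g p) (f p) < rank (zeros_before g p) (g p)"
    using p(1) zeros_before_cong[of p f g] by (simp add: key_def)
  ultimately show thesis
    by (rule that)
qed

lemma less_fun_keyI:
  assumes "\<And>i. i < p \<Longrightarrow> f i = g i"
    and "rank (zeros_before g p) (f p) < rank (zeros_before g p) (g p)"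
  shows "less_fun (key f) (key g)"
proof (rule less_funI)
  show "\<exists>p. key f p < key g p \<and> (\<forall>i<p. key f i = key g i)"
    using assms zeros_before_cong[of p f g] key_cong[of _ f g]
    by (intro exI[of _ p]) (auto simp: key_def)
qed

text \<open>The count of zeros grows in steps of one, and only at zeros, so it leaves each value
  \<open>c\<close> at a zero; there the letter \<open>c\<close> is favoured.\<close>

lemma exists_nth_zero:
  assumes "c < zeros_before g N"
  shows "\<exists>q<N. g q = 0 \<and> zeros_before g q = c"
  using assms
proof (induction N)
  case 0
  then show ?case by (simp add: zeros_before_def)
next
  case (Suc N)
  have "{i. i < Suc N \<and> g i = 0} =
      (if g N = 0 then insert N {i. i < N \<and> g i = 0} else {i. i < N \<and> g i = 0})"
    by (auto simp: less_Suc_eq)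
  then have "zeros_before g (Suc N) = (if g N = 0 then Suc (zeros_before g N) else zeros_before g N)"
    by (simp add: zeros_before_def)
  then show ?case
    using Suc less_Suc_eq by (auto split: if_splits)
qed

text \<open>\<open>f j \<noteq> g j\<close> will make the moved rook one that \<open>f\<close>
  lacks. Zeros are counted only up to \<open>m\<close>, since there are infinitely many beyond; the
  dummy zero raises the bound from \<open>n - 1\<close> to \<open>n\<close>.\<close>

lemma exists_earlier_exchange:
  fixes f g :: "nat \<Rightarrow> nat"
  assumes less: "less_fun (key f) (key g)"
    and f0: "f 0 = 0" and g0: "g 0 = 0"
    and f_gt: "\<And>j. j > m \<Longrightarrow> f j = 0" and g_gt: "\<And>j. j > m \<Longrightarrow> g j = 0"
    and f_le: "\<And>j. f j \<le> n" and g_le: "\<And>j. g j \<le> n"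
    and card_eq: "\<And>i. i > 0 \<Longrightarrow> card {j. f j = i} = card {j. g j = i}"
    and zeros_eq: "zeros_before f (Suc m) = zeros_before g (Suc m)"
    and zeros_ge: "zeros_before g (Suc m) \<ge> n"
  shows "\<exists>j q. g j \<noteq> 0 \<and> f j \<noteq> g j \<and> q \<in> {1..m} \<and> g q = 0 \<and>
    less_fun (key (g(q := g j, j := 0))) (key g)"
proof -
  obtain p where eq: "\<And>i. i < p \<Longrightarrow> f i = g i"
    and rank_less: "rank (zeros_before g p) (f p) < rank (zeros_before g p) (g p)"
    using less_fun_keyE[OF less] by blast
  have "f p \<noteq> g p"
    using rank_less by fastforce
  have g_p: "g p \<noteq> zeros_before g p"
    using rank_less by (auto simp: rank_def)
  have "p \<noteq> 0" "\<not> p > m"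
    using f0 g0 f_gt[of p] g_gt[of p] \<open>f p \<noteq> g p\<close> by metis+
  then have p: "p \<in> {1..m}"
    by simp
  \<comment> \<open>Otherwise every \<open>f p\<close> in \<open>g\<close> would also be one in
    \<open>f\<close>; equal cardinalities would make the two sets of positions coincide, although
    \<open>p\<close> lies in only one.\<close>
  have missing: "\<exists>j>p. g j = f p \<and> f j \<noteq> f p" if "f p \<noteq> 0"
  proof (rule ccontr)
    assume none: "\<not> ?thesis"
    have "{j. g j = f p} \<subseteq> {j. f j = f p}"
    proof
      fix j assume "j \<in> {j. g j = f p}"
      then have j: "g j = f p"
        by simp
      then consider "j < p" | "j > p"
        using \<open>f p \<noteq> g p\<close> by (metis linorder_neqE_nat)
      then have "f j = f p"
        using none eq j by metis
      then show "j \<in> {j. f j = f p}"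
        by simp
    qed
    moreover have "finite {j. f j = f p}"
    proof (rule finite_subset)
      show "{j. f j = f p} \<subseteq> {..m}"
        using f_gt that by (metis (mono_tags, lifting) atMost_iff mem_Collect_eq not_le subsetI)
    qed simp
    ultimately have "{j. g j = f p} = {j. f j = f p}"
      using card_eq[of "f p"] that by (intro card_subset_eq) auto
    then have "p \<in> {j. g j = f p}"
      by (simp only: mem_Collect_eq)
    then show False
      using \<open>f p \<noteq> g p\<close> by simp
  qed
  show ?thesis
  proof (cases "g p = 0")
    case True
    \<comment> \<open>Here zero has rank 1, so only the favoured letter ranks below it.\<close>
    then have f_p: "f p = zeros_before g p" "f p \<noteq> 0"
      using rank_less g_p by (auto simp: rank_def split: if_splits)
    then obtain j where j: "j > p" "g j = f p" "f j \<noteq> f p"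
      using missing by blast
    have "less_fun (key (g(p := g j, j := 0))) (key g)"
      by (rule less_fun_keyI[of p]) (use j f_p True in \<open>auto simp: rank_def\<close>)
    then show ?thesis
      using j f_p p True by (intro exI[of _ j] exI[of _ p]) auto
  next
    case g_nz: False
    show ?thesis
    proof (cases "\<exists>q\<in>{p..m}. g q = 0")
      case True
      then obtain q where q: "q \<in> {p..m}" "g q = 0"
        by blast
      then have "q > p"
        using g_nz by (cases "q = p") auto
      \<comment> \<open>By \<open>g_p\<close> the letter \<open>g p\<close> is not favoured, so
        putting a zero at \<open>p\<close> lowers the rank.\<close>
      have "less_fun (key (g(q := g p, p := 0))) (key g)"
        by (rule less_fun_keyI[of p]) (use q \<open>q > p\<close> g_nz g_p in \<open>auto simp: rank_def\<close>)
      then show ?thesis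
        using q p g_nz \<open>f p \<noteq> g p\<close> by (intro exI[of _ p] exI[of _ q]) auto
    next
      case no_zero: False
      have zeros: "{i. i < Suc m \<and> g i = 0} = {i. i < p \<and> g i = 0}"
      proof -
        have "i < p" if "i < Suc m" "g i = 0" for i
          using no_zero that by (metis atLeastAtMost_iff less_Suc_eq_le not_le)
        then show ?thesis
          using p by auto
      qed
      \<comment> \<open>As \<open>f\<close> shares all zeros of \<open>g\<close>, which precede
        \<open>p\<close>, a zero at \<open>p\<close> would give it one too many.\<close>
      have "f p \<noteq> 0"
      proof
        assume "f p = 0"
        have "{i. i < Suc m \<and> g i = 0} \<subset> {i. i < Suc m \<and> f i = 0}"
        proof (rule psubsetI)
          show "{i. i < Suc m \<and> g i = 0} \<subseteq> {i. i < Suc m \<and> f i = 0}"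
            unfolding zeros using eq p by auto
          have "p \<in> {i. i < Suc m \<and> f i = 0}"
            using p \<open>f p = 0\<close> by simp
          moreover have "p \<notin> {i. i < Suc m \<and> g i = 0}"
            using g_nz by simp
          ultimately show "{i. i < Suc m \<and> g i = 0} \<noteq> {i. i < Suc m \<and> f i = 0}"
            by metis
        qed
        then have "zeros_before g (Suc m) < zeros_before f (Suc m)"
          unfolding zeros_before_def by (rule psubset_card_mono[rotated]) simp
        then show False
          using zeros_eq by simp
      qed
      \<comment> \<open>Only letters below \<open>n\<close> are sure to have been favoured at a
        zero. If \<open>g p = n\<close>, then \<open>f p < n\<close>, and \<open>missing\<close>
        supplies a later \<open>f p\<close> in \<open>g\<close>.\<close>
      obtain j where j: "j \<ge> p" "g j \<noteq> 0" "f j \<noteq> g j" "g j < n"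
      proof (cases "g p < n")
        case True
        then show ?thesis
          using that[of p] g_nz \<open>f p \<noteq> g p\<close> by auto
      next
        case False
        then have "f p < n"
          using f_le[of p] g_le[of p] \<open>f p \<noteq> g p\<close> by auto
        then show ?thesis
          using missing[OF \<open>f p \<noteq> 0\<close>] that \<open>f p \<noteq> 0\<close> by (metis less_imp_le)
      qed
      have "zeros_before g p \<ge> n"
        using zeros_ge zeros by (simp add: zeros_before_def)
      then obtain q where q: "q < p" "g q = 0" "zeros_before g q = g j"
        using exists_nth_zero[of "g j" g p] j by auto
      \<comment> \<open>The dummy zero has count 0, whereas \<open>g j\<close> is nonzero.\<close>
      have "q > 0"
        using q j by (cases "q = 0") (auto simp: zeros_before_def)
      have "less_fun (key (g(q := g j, j := 0))) (key g)"
        by (rule less_fun_keyI[of q]) (use q j in \<open>auto simp: rank_def\<close>)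
      then show ?thesis
        using q j p \<open>q > 0\<close> by (intro exI[of _ j] exI[of _ q]) auto
    qed
  qed
qed

subsection \<open>Facets of the chessboard complex\<close>

lemma card_Int_row:
  fixes m n :: nat
  assumes "A \<subseteq> {1..m} \<times> {1..n}"
  shows "card (A \<inter> ({1..m} \<times> {i})) = card {j. (j, i) \<in> A}"
proof -
  have "A \<inter> ({1..m} \<times> {i}) = (\<lambda>j. (j, i)) ` {j. (j, i) \<in> A}"
    using assms by auto
  then show ?thesis
    by (simp add: card_image inj_on_def)
qed

lemma mem_chessboard_complex_iff:
  "A \<in> chessboard_complex m n k \<longleftrightarrow>
     A \<subseteq> {1..m} \<times> {1..n} \<and> (\<forall>i\<in>{1..n}. card {j. (j, i) \<in> A} \<le> k i) \<and>
     (\<forall>j i i'. (j, i) \<in> A \<longrightarrow> (j, i') \<in> A \<longrightarrow> i = i')"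
proof -
  have "(\<forall>j\<in>{1..m}. card (A \<inter> ({j} \<times> {1..n})) \<le> 1) \<longleftrightarrow>
      (\<forall>j i i'. (j, i) \<in> A \<longrightarrow> (j, i') \<in> A \<longrightarrow> i = i')" if A: "A \<subseteq> {1..m} \<times> {1..n}"
  proof -
    have "card (A \<inter> ({j} \<times> {1..n})) \<le> 1 \<longleftrightarrow>
        (\<forall>i i'. (j, i) \<in> A \<longrightarrow> (j, i') \<in> A \<longrightarrow> i = i')" for j
    proof -
      have "A \<inter> ({j} \<times> {1..n}) = Pair j ` {i. (j, i) \<in> A}"
        using A by auto
      moreover have "finite {i. (j, i) \<in> A}"
        by (rule finite_subset[of _ "{1..n}"]) (use A in auto)
      ultimately show ?thesis
        by (simp add: card_image inj_on_def card_le_Suc0_iff_eq)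
    qed
    then show ?thesis
      using A by blast
  qed
  then show ?thesis
    unfolding chessboard_complex_def mem_Collect_eq
    by (intro conj_cong) (simp_all only: card_Int_row refl)
qed

lemma chessboard_complexD:
  assumes "A \<in> chessboard_complex m n k" and "(j, i) \<in> A"
  shows "j \<in> {1..m}" and "i \<in> {1..n}"
  using assms unfolding mem_chessboard_complex_iff by blast+

lemma chessboard_complex_unique:
  assumes "A \<in> chessboard_complex m n k" and "(j, i) \<in> A" and "(j, i') \<in> A"
  shows "i = i'"
  using assms unfolding mem_chessboard_complex_iff by blast

lemma finite_simplicial_complex_chessboard:
  "finite_simplicial_complex (chessboard_complex m n k)"
  unfolding finite_simplicial_complex_def
proof (intro conjI ballI allI impI)
  show "finite (chessboard_complex m n k)"
    by (rule finite_subset[of _ "Pow ({1..m} \<times> {1..n})"]) (auto simp: chessboard_complex_def)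
  show "{} \<in> chessboard_complex m n k"
    by (simp add: mem_chessboard_complex_iff)
next
  fix A assume A: "A \<in> chessboard_complex m n k"
  then show fin: "finite A"
    unfolding mem_chessboard_complex_iff
    by (meson finite_SigmaI finite_atLeastAtMost finite_subset)
  fix B assume B: "B \<subseteq> A"
  have "card {j. (j, i) \<in> B} \<le> card {j. (j, i) \<in> A}" for i
  proof (rule card_mono)
    show "finite {j. (j, i) \<in> A}"
      by (rule finite_subset[of _ "fst ` A"]) (use fin in force)+
  qed (use B in auto)
  then show "B \<in> chessboard_complex m n k"
    using A B unfolding mem_chessboard_complex_iff by (meson order_trans subsetD)
qed

lemma card_eq_sum_rows:
  fixes m n :: nat
  assumes "A \<subseteq> {1..m} \<times> {1..n}"
  shows "card A = (\<Sum>i\<in>{1..n}. card {j. (j, i) \<in> A})"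
proof -
  have "card A = (\<Sum>i\<in>{1..n}. card (A \<inter> ({1..m} \<times> {i})))"
  proof (subst card_UN_disjoint[symmetric])
    show "card A = card (\<Union>i\<in>{1..n}. A \<inter> ({1..m} \<times> {i}))"
      by (rule arg_cong[where f = card]) (use assms in auto)
    show "\<forall>i\<in>{1..n}. finite (A \<inter> ({1..m} \<times> {i}))"
      using finite_subset[OF assms] by simp
  qed auto
  then show ?thesis
    unfolding card_Int_row[OF assms] .
qed

lemma card_columns:
  assumes "A \<in> chessboard_complex m n k"
  shows "card (fst ` A) = card A"
  using assms by (intro card_image) (auto simp: mem_chessboard_complex_iff inj_on_def)

text \<open>A deficient row leaves fewer than \<open>m\<close> rooks, hence an empty column where a
  rook can be added to that row. Conversely, full rows give the largest possible
  cardinality.\<close>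

lemma facets_chessboard_complex:
  assumes "m \<ge> (\<Sum>i\<in>{1..n}. k i)"
  shows "facets (chessboard_complex m n k) =
    {A \<in> chessboard_complex m n k. \<forall>i\<in>{1..n}. card {j. (j, i) \<in> A} = k i}"
    (is "_ = ?F")
proof (intro equalityI subsetI)
  let ?K = "chessboard_complex m n k"
  fix A assume "A \<in> facets ?K"
  then have A: "A \<in> ?K" and maximal: "\<And>B. B \<in> ?K \<Longrightarrow> A \<subseteq> B \<Longrightarrow> B = A"
    by (auto simp: facets_def)
  have A_sub: "A \<subseteq> {1..m} \<times> {1..n}"
    using A by (simp add: mem_chessboard_complex_iff)
  then have fin: "finite A"
    by (rule finite_subset) simp
  have le: "card {j. (j, i) \<in> A} \<le> k i" if "i \<in> {1..n}" for i
    using A that by (simp add: mem_chessboard_complex_iff)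
  have "card {j. (j, i) \<in> A} = k i" if i: "i \<in> {1..n}" for i
  proof (rule ccontr)
    assume "\<not> ?thesis"
    then have less: "card {j. (j, i) \<in> A} < k i"
      using le[OF i] by simp
    then have "card A < (\<Sum>i\<in>{1..n}. k i)"
      unfolding card_eq_sum_rows[OF A_sub] using le i by (intro sum_strict_mono_ex1) auto
    then have "card (fst ` A) < card {1..m}"
      using card_columns[OF A] assms by simp
    then obtain q where q: "q \<in> {1..m}" "q \<notin> fst ` A"
      using fin by (metis card_mono finite_imageI not_le subsetI)
    then have q_free: "(q, i') \<notin> A" for i'
      by force
    have "card {j. (j, i') \<in> insert (q, i) A} \<le> k i'" if "i' \<in> {1..n}" for i'
    proof (cases "i' = i")
      case True
      then have "{j. (j, i') \<in> insert (q, i) A} = insert q {j. (j, i) \<in> A}"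
        by auto
      then show ?thesis
        using less True card_insert_le_m1[of "k i" "{j. (j, i) \<in> A}" q] by auto
    next
      case False
      then show ?thesis
        using le[OF that] by simp
    qed
    then have "insert (q, i) A \<in> ?K"
      using A q i q_free by (auto simp: mem_chessboard_complex_iff)
    then show False
      using maximal[of "insert (q, i) A"] q_free by auto
  qed
  with A show "A \<in> ?F"
    by simp
next
  fix A assume "A \<in> ?F"
  then have A: "A \<in> chessboard_complex m n k"
    and rows: "\<And>i. i \<in> {1..n} \<Longrightarrow> card {j. (j, i) \<in> A} = k i"
    by auto
  have "B = A" if B: "B \<in> chessboard_complex m n k" and sub: "A \<subseteq> B" for B
  proof -
    have *: "A \<subseteq> {1..m} \<times> {1..n}" "B \<subseteq> {1..m} \<times> {1..n}"
      using A B by (auto simp: mem_chessboard_complex_iff)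
    have "card B \<le> card A"
      unfolding card_eq_sum_rows[OF *(1)] card_eq_sum_rows[OF *(2)]
      using B rows by (intro sum_mono) (simp add: mem_chessboard_complex_iff)
    moreover have "finite B"
      using *(2) by (rule finite_subset) simp
    ultimately show ?thesis
      using sub by (metis card_seteq)
  qed
  with A show "A \<in> facets (chessboard_complex m n k)"
    by (auto simp: facets_def)
qed

subsection \<open>The word of a rook placement\<close>

text \<open>Each column holds at most one rook, so the sum has at most one term.\<close>

definition word :: "(nat \<times> nat) set \<Rightarrow> nat \<Rightarrow> nat" where
  "word A j = \<Sum>(A `` {j})"

text \<open>Rows are numbered from 1, which leaves the letter 0, the empty sum, for empty
  columns.\<close>

lemma word_eq_iff:
  assumes "A \<in> chessboard_complex m n k" and "i > 0"
  shows "word A j = i \<longleftrightarrow> (j, i) \<in> A"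
proof (cases "\<exists>i'. (j, i') \<in> A")
  case True
  then obtain i' where i': "(j, i') \<in> A"
    by blast
  then have "A `` {j} = {i'}"
    using chessboard_complex_unique[OF assms(1)] by blast
  then show ?thesis
    using i' unfolding word_def by auto
next
  case False
  then have "A `` {j} = {}"
    by auto
  then show ?thesis
    using False assms(2) unfolding word_def by auto
qed

lemma word_eq_0_iff:
  assumes "A \<in> chessboard_complex m n k"
  shows "word A j = 0 \<longleftrightarrow> j \<notin> fst ` A"
proof
  assume "word A j = 0"
  show "j \<notin> fst ` A"
  proof
    assume "j \<in> fst ` A"
    then obtain i where i: "(j, i) \<in> A"
      by auto
    then have "i > 0"
      using chessboard_complexD(2)[OF assms] by fastforce
    then show False
      using word_eq_iff[OF assms, of i j] i \<open>word A j = 0\<close> by simp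
  qed
next
  assume j: "j \<notin> fst ` A"
  have "(j, word A j) \<in> A" if "word A j > 0"
    using word_eq_iff[OF assms that, of j] by simp
  then show "word A j = 0"
    using j by (metis fst_conv gr0I image_eqI)
qed

lemma word_le:
  assumes "A \<in> chessboard_complex m n k"
  shows "word A j \<le> n"
proof (cases "word A j = 0")
  case False
  then have "(j, word A j) \<in> A"
    using word_eq_iff[OF assms, of "word A j" j] by simp
  then show ?thesis
    using chessboard_complexD(2)[OF assms] by simp
qed simp

lemma word_outside:
  assumes "A \<in> chessboard_complex m n k" and "j \<notin> {1..m}"
  shows "word A j = 0"
  unfolding word_eq_0_iff[OF assms(1)]
  using assms(2) by (auto dest: chessboard_complexD(1)[OF assms(1)])

lemma inj_on_word: "inj_on word (chessboard_complex m n k)"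
proof (rule inj_onI)
  fix A B assume A: "A \<in> chessboard_complex m n k" and B: "B \<in> chessboard_complex m n k"
    and "word A = word B"
  then have *: "(j, i) \<in> A \<longleftrightarrow> (j, i) \<in> B" if "i > 0" for i j
    using word_eq_iff[OF A that] word_eq_iff[OF B that] by simp
  have "i > 0" if "(j, i) \<in> A \<union> B" for i j
    using that by (auto dest: chessboard_complexD(2)[OF A] chessboard_complexD(2)[OF B])
  with * show "A = B"
    by (metis Un_iff subrelI subset_antisym)
qed

text \<open>Of the \<open>m + 1\<close> positions, counting the dummy one, exactly the
  \<open>card A\<close> occupied columns carry nonzero letters.\<close>

lemma zeros_before_word:
  assumes "A \<in> chessboard_complex m n k"
  shows "zeros_before (word A) (Suc m) = Suc m - card A"
proof -
  have sub: "fst ` A \<subseteq> {..m}"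
    by (auto dest: chessboard_complexD(1)[OF assms])
  have "{i. i < Suc m \<and> word A i = 0} = {..m} - fst ` A"
    using word_eq_0_iff[OF assms] by auto
  then show ?thesis
    using sub card_columns[OF assms]
    by (simp add: zeros_before_def card_Diff_subset finite_subset)
qed

section \<open>Moving a rook along its row to an empty column\<close>

lemma word_exchange:
  assumes "(j, b) \<in> B" and "B \<in> chessboard_complex m n k" and "word B q = 0"
  shows "word (insert (q, b) (B - {(j, b)})) = (word B)(q := b, j := 0)"
proof
  have q: "(q, i) \<notin> B" for i
    using assms(3) unfolding word_eq_0_iff[OF assms(2)] by (metis fst_conv image_eqI)
  have *: "B `` {j} = {b}" "B `` {q} = {}" "q \<noteq> j"
    using assms(1) q chessboard_complex_unique[OF assms(2)] by blast+
  fix x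
  have "insert (q, b) (B - {(j, b)}) `` {x} =
      (if x = q then {b} else if x = j then {} else B `` {x})"
    using * by auto
  then show "word (insert (q, b) (B - {(j, b)})) x = ((word B)(q := b, j := 0)) x"
    using * by (simp add: word_def)
qed

lemma exchange_in_facets:
  assumes m: "m \<ge> (\<Sum>i\<in>{1..n}. k i)" and B: "B \<in> facets (chessboard_complex m n k)"
    and jb: "(j, b) \<in> B" and q: "q \<in> {1..m}" "\<And>i. (q, i) \<notin> B"
  shows "insert (q, b) (B - {(j, b)}) \<in> facets (chessboard_complex m n k)" (is "?C \<in> _")
proof -
  have B': "B \<in> chessboard_complex m n k"
    and rows: "\<And>i. i \<in> {1..n} \<Longrightarrow> card {j. (j, i) \<in> B} = k i"
    using B unfolding facets_chessboard_complex[OF m] by auto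
  have rows': "card {j. (j, i) \<in> ?C} = k i" if i: "i \<in> {1..n}" for i
  proof (cases "i = b")
    case True
    then have "{j. (j, i) \<in> ?C} = insert q ({j. (j, i) \<in> B} - {j})"
      by auto
    moreover have fin: "finite {j. (j, i) \<in> B}"
      by (rule finite_subset[of _ "{1..m}"]) (auto dest: chessboard_complexD(1)[OF B'])
    ultimately have "card {j. (j, i) \<in> ?C} = Suc (card ({j. (j, i) \<in> B} - {j}))"
      using q(2) by simp
    also have "\<dots> = card {j. (j, i) \<in> B}"
      using True jb fin by (intro card_Suc_Diff1) auto
    finally show ?thesis
      using rows[OF i] by simp
  next
    case False
    then have "{j. (j, i) \<in> ?C} = {j. (j, i) \<in> B}"
      by auto
    then show ?thesis
      using rows[OF i] by simp
  qed
  moreover have "?C \<in> chessboard_complex m n k"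
  proof -
    have "?C \<subseteq> {1..m} \<times> {1..n}"
      using B' chessboard_complexD(2)[OF B' jb] q(1) unfolding mem_chessboard_complex_iff by blast
    moreover have "i = i'" if "(x, i) \<in> ?C" "(x, i') \<in> ?C" for x i i'
      using chessboard_complex_unique[OF B'] q(2) that by blast
    moreover have "\<forall>i\<in>{1..n}. card {j. (j, i) \<in> ?C} \<le> k i"
      using rows' by (intro ballI) (rule eq_imp_le)
    ultimately show ?thesis
      unfolding mem_chessboard_complex_iff by meson
  qed
  ultimately show ?thesis
    unfolding facets_chessboard_complex[OF m] by simp
qed

section \<open>The shelling order\<close>

theorem theorem4p4:
  fixes m n :: nat and k :: "nat \<Rightarrow> nat"
  assumes "m \<ge> 1" and "n \<ge> 1"
    and "m \<ge> (\<Sum>i\<in>{1..n}. k i) + n - 1"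
  shows "shellable (chessboard_complex m n k)"
proof -
  let ?K = "chessboard_complex m n k"
  have m: "m \<ge> (\<Sum>i\<in>{1..n}. k i)"
    using assms by simp
  note facets = facets_chessboard_complex[OF m]
  have card_facet: "card A = (\<Sum>i\<in>{1..n}. k i)" if "A \<in> facets ?K" for A
    using that card_eq_sum_rows[of A m n] unfolding facets
    by (auto simp: mem_chessboard_complex_iff)
  \<comment> \<open>This relates arbitrary sets; only totality uses that they are facets.\<close>
  define r where "r = {(A, B). less_fun (key (word A)) (key (word B))}"
  have "strict_linear_order_on (facets ?K) r"
    unfolding strict_linear_order_on_def
  proof (intro conjI)
    show "trans r"
      unfolding r_def by (auto intro!: transI elim: less_fun_trans)
    show "irrefl r"
      unfolding r_def by (auto intro!: irreflI simp: less_fun_irrefl)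
    show "total_on (facets ?K) r"
    proof (rule total_onI)
      fix A B assume AB: "A \<in> facets ?K" "B \<in> facets ?K" "A \<noteq> B"
      then have K: "A \<in> ?K" "B \<in> ?K"
        by (auto simp: facets)
      \<comment> \<open>Trichotomy of \<open>less_fun\<close> requires finitely many differences. At
        position 0 the favoured letter is zero itself; later the count is positive, so zero has rank
        1.\<close>
      have key_outside: "key (word X) j = (if j = 0 then 0 else 1)" if "X \<in> ?K" "j \<notin> {1..m}" for X j
      proof (cases "j = 0")
        case True
        then show ?thesis
          using word_outside[OF that] by (simp add: key_def rank_def zeros_before_def)
      next
        case False
        then have "0 \<in> {i. i < j \<and> word X i = 0}"
          using word_outside[OF that(1), of 0] by simp
        then have "zeros_before (word X) j > 0"
          unfolding zeros_before_def card_gt_0_iff by fastforce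
        then show ?thesis
          using False word_outside[OF that] by (simp add: key_def rank_def)
      qed
      have "key (word A) j = key (word B) j" if "j \<notin> {1..m}" for j
        unfolding key_outside[OF K(1) that] key_outside[OF K(2) that] ..
      then have "{j. key (word A) j \<noteq> key (word B) j} \<subseteq> {1..m}"
        by blast
      then have "finite {j. key (word A) j \<noteq> key (word B) j}"
        by (rule finite_subset) simp
      then have "less_fun (key (word A)) (key (word B)) \<or> key (word A) = key (word B) \<or>
          less_fun (key (word B)) (key (word A))"
        by (rule less_fun_trichotomy)
      moreover have "word A \<noteq> word B"
        using K AB(3) inj_on_word by (meson inj_onD)
      ultimately show "(A, B) \<in> r \<or> (B, A) \<in> r"
        by (auto simp: r_def key_inject)
    qed
  qed
  moreover have "\<exists>C\<in>facets ?K. (C, B) \<in> r \<and> (\<exists>v\<in>B. A \<inter> B \<subseteq> C \<inter> B \<and> C \<inter> B = B - {v})"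
    if A: "A \<in> facets ?K" and B: "B \<in> facets ?K" and AB: "(A, B) \<in> r" for A B
  proof -
    have K: "A \<in> ?K" "B \<in> ?K"
      using A B by (auto simp: facets)
    have cards: "card {j. word A j = i} = card {j. word B j = i}" if "i > 0" for i
    proof (cases "i \<in> {1..n}")
      case True
      then show ?thesis
        unfolding word_eq_iff[OF K(1) that] word_eq_iff[OF K(2) that]
        using A B by (simp add: facets)
    next
      case False
      then have "i > n"
        using that by simp
      then have "word A j \<noteq> i" "word B j \<noteq> i" for j
        using word_le[OF K(1), of j] word_le[OF K(2), of j] by auto
      then show ?thesis
        by simp
    qed
    have "less_fun (key (word A)) (key (word B))"
      using AB by (simp add: r_def)
    moreover have "word A 0 = 0" "word B 0 = 0" "\<And>j. j > m \<Longrightarrow> word A j = 0" "\<And>j. j > m \<Longrightarrow> word B j = 0"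
      using K[THEN word_outside] by auto
    moreover note K[THEN word_le] cards
    \<comment> \<open>Both counts are \<open>Suc m\<close> minus the sum of the \<open>k i\<close>,
      which the hypothesis on \<open>m\<close> makes at least \<open>n\<close>.\<close>
    moreover have "zeros_before (word A) (Suc m) = zeros_before (word B) (Suc m)"
      "zeros_before (word B) (Suc m) \<ge> n"
      using K[THEN zeros_before_word] card_facet[OF A] card_facet[OF B] assms by simp_all
    ultimately have "\<exists>j q. word B j \<noteq> 0 \<and> word A j \<noteq> word B j \<and> q \<in> {1..m} \<and> word B q = 0 \<and>
        less_fun (key ((word B)(q := word B j, j := 0))) (key (word B))"
      by (rule exists_earlier_exchange)
    then obtain j q where j: "word B j \<noteq> 0" "word A j \<noteq> word B j"
      and q: "q \<in> {1..m}" "word B q = 0"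
      and less: "less_fun (key ((word B)(q := word B j, j := 0))) (key (word B))"
      by blast
    define b where "b = word B j"
    define C where "C = insert (q, b) (B - {(j, b)})"
    have jb: "(j, b) \<in> B" "(j, b) \<notin> A"
      using j K[THEN word_eq_iff, of b j] by (auto simp: b_def)
    have q_free: "(q, i) \<notin> B" for i
      using q(2) unfolding word_eq_0_iff[OF K(2)] by (metis fst_conv image_eqI)
    have "C \<in> facets ?K"
      unfolding C_def using exchange_in_facets[OF m B jb(1) q(1) q_free] .
    moreover have "(C, B) \<in> r"
      using less word_exchange[OF jb(1) K(2) q(2)] by (simp add: r_def C_def b_def)
    moreover have "C \<inter> B = B - {(j, b)}"
      using q_free by (auto simp: C_def)
    \<comment> \<open>The vertex removed is \<open>(j, b)\<close>; as it is not in \<open>A\<close>,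
      the set \<open>A \<inter> B\<close> survives in \<open>C\<close>.\<close>
    ultimately show ?thesis
      using jb by blast
  qed
  ultimately have "shelling_order ?K r"
    by (auto simp: shelling_order_def)
  then show ?thesis
    unfolding shellable_def pure_complex_def
    using finite_simplicial_complex_chessboard card_facet by metis
qed

end
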